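(* Let $\alpha>0$ and let $X=\{(\lambda,m_\lambda)\}_{\lambda\in\Lambda}$ be a divisor in $\mathbb{D}$. (a) If $X$ is a sampling divisor for $\mathcal{A}^\infty_\alpha$, then there exists $0<C<\alpha$ such that $$\bigcup_{\lambda\in\Lambda}D\left(\lambda,\sqrt{\frac{m_\lambda+C}{m_\lambda+\alpha}}\right)=\mathbb{D}.$$ (b) Conversely, if there exists $C>0$ such that for some compact set $K\subset\mathbb{D}$ we have $$\bigcup_{\lambda\in\Lambda,\ m_\lambda>C}D\left(\lambda,\sqrt{\frac{m_\lambda-C}{m_\lambda+\alpha}}\right)=\mathbb{D}\setminus K,$$ then $X$ is a sampling divisor for $\mathcal{A}^\infty_\alpha$.
   Context: $\mathbb{D}$ is the open unit disk in $\mathbb{C}$. For $\alpha>0$, $\mathcal{A}^\infty_\alpha$ is the space of holomorphic functions $f$ on $\mathbb{D}$ with $\|f\|_{\alpha,\infty}:=\sup_{z\in\mathbb{D}}(1-|z|^2)^{\alpha/2}|f(z)|<\infty$. For $\lambda\in\mathbb{D}$ and $0<r<1$, $D(\lambda,r)=\{z\in\mathbb{D}:\left|\frac{\lambda-z}{1-\overline{\lambda}z}\right|<r\}$ is the pseudohyperbolic disk. A divisor is a set $X=\{(\lambda,m_\lambda)\}_{\lambda\in\Lambda}$, where $\Lambda\subset\mathbb{D}$ is a set of (distinct) points and each $m_\lambda\ge1$ is an integer (multiplicity). For $\lambda\in\Lambda$ put $N_\lambda^\infty=\{f\in\mathcal{A}^\infty_\alpha: f^{(j)}(\lambda)=0,\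 \forall\,0\le j<m_\lambda\}$, and let $\|f\|_{\mathcal{A}^\infty_\alpha/N_\lambda^\infty}=\inf_{g\in N_\lambda^\infty}\|f-g\|_{\alpha,\infty}$ be the quotient norm. $X$ is sampling for $\mathcal{A}^\infty_\alpha$ if there exists $L>0$ such that $\|f\|_{\alpha,\infty}\le L\sup_{\lambda\in\Lambda}\|f\|_{\mathcal{A}^\infty_\alpha/N_\lambda^\infty}$ for all $f\in\mathcal{A}^\infty_\alpha$. *)

theory Defs
  imports "HOL-Complex_Analysis.Complex_Analysis"
begin

abbreviation unit_disk :: "complex set" ("\<D>") where
  "\<D> \<equiv> ball 0 1"

definition pseudohyperbolic_disk :: "complex \<Rightarrow> real \<Rightarrow> complex set" where
  "pseudohyperbolic_disk l r = {z \<in> \<D>. cmod ((l - z) / (1 - cnj l * z)) < r}"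

text \<open>
  Functions on the disk are represented by total functions on the complex plane whose values
  outside the disk are irrelevant. The growth norm is only meaningful on the growth space,
  where the supremum is finite.
\<close>

definition growth_norm :: "real \<Rightarrow> (complex \<Rightarrow> complex) \<Rightarrow> real" where
  "growth_norm \<alpha> f = (SUP z\<in>\<D>. (1 - (cmod z)\<^sup>2) powr (\<alpha> / 2) * cmod (f z))"

definition growth_space :: "real \<Rightarrow> (complex \<Rightarrow> complex) set" where
  "growth_space \<alpha> = {f. f holomorphic_on \<D> \<and>
     bdd_above ((\<lambda>z. (1 - (cmod z)\<^sup>2) powr (\<alpha> / 2) * cmod (f z)) ` \<D>)}"

text \<open>A divisor is given by its support \<open>\<Lambda>\<close> and its multiplicities \<open>m\<close>; the values of \<open>m\<close>
  outside \<open>\<Lambda>\<close> play no role.\<close>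

definition divisor :: "complex set \<Rightarrow> (complex \<Rightarrow> nat) \<Rightarrow> bool" where
  "divisor \<Lambda> m \<longleftrightarrow> \<Lambda> \<subseteq> \<D> \<and> (\<forall>l\<in>\<Lambda>. m l \<ge> 1)"

definition vanishing_space :: "real \<Rightarrow> complex \<Rightarrow> nat \<Rightarrow> (complex \<Rightarrow> complex) set" where
  "vanishing_space \<alpha> l k = {f \<in> growth_space \<alpha>. \<forall>j<k. (deriv ^^ j) f l = 0}"

definition quotient_norm :: "real \<Rightarrow> complex \<Rightarrow> nat \<Rightarrow> (complex \<Rightarrow> complex) \<Rightarrow> real" where
  "quotient_norm \<alpha> l k f = (INF g\<in>vanishing_space \<alpha> l k. growth_norm \<alpha> (\<lambda>z. f z - g z))"

text \<open>
  The quotient norms below are bounded by the growth norm of \<open>f\<close>, so the supremum is finite.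
  Inserting \<open>0\<close> into the set of values only matters for empty \<open>\<Lambda>\<close>, where it makes the supremum of the
  (nonnegative) quotient norms equal to \<open>0\<close> instead of leaving it unspecified.
\<close>

definition sampling_divisor :: "real \<Rightarrow> complex set \<Rightarrow> (complex \<Rightarrow> nat) \<Rightarrow> bool" where
  "sampling_divisor \<alpha> \<Lambda> m \<longleftrightarrow> (\<exists>L>0. \<forall>f\<in>growth_space \<alpha>.
     growth_norm \<alpha> f \<le> L * Sup (insert 0 ((\<lambda>l. quotient_norm \<alpha> l (m l) f) ` \<Lambda>)))"

end

theory Submission
  imports Defs
begin

text \<open>
  The weighted composition \<open>f \<mapsto> (f \<circ> \<phi>\<^sub>l) \<sqdot> k\<^sub>l\<close> with the disk involution \<open>\<phi>\<^sub>l\<close> and the kernel \<open>k\<^sub>l\<close>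
  preserves the growth norm and turns conditions at \<open>l\<close> into conditions at the origin.

  (a) If \<open>z\<close> is not covered for \<open>C = \<alpha> - \<epsilon>\<close>, then \<open>k\<^sub>z\<close> has norm at least \<open>1\<close>, while at each \<open>l\<close> its
  transport is a unimodular multiple of \<open>k\<^sub>a\<close> with \<open>a = \<phi>\<^sub>l(z)\<close> and \<open>1 - |a|\<^sup>2 \<le> \<epsilon> / m\<close>. The Taylor
  polynomial of degree \<open>< m\<close> of \<open>k\<^sub>a\<close> represents the same class and has norm \<open>O(\<epsilon>\<close> to the power
  \<open>\<alpha> / 2)\<close>, so small \<open>\<epsilon>\<close> contradicts sampling.

  (b) By the maximum principle, a function \<open>g\<close> with a zero of order \<open>m\<close> at \<open>l\<close> has weighted modulus at
  most \<open>\<eta>\<close> times its norm on the disk of squared radius \<open>(m - C) / (m + \<alpha>)\<close>, with \<open>\<eta> < 1\<close> depending only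
  on \<open>\<alpha>\<close> and \<open>C\<close>. Hence off \<open>K\<close> the weighted modulus of \<open>f\<close> is at most \<open>\<eta>\<close> times its norm plus twice the
  largest quotient norm. Applying this to \<open>z\<^sup>n f(z)\<close> with \<open>n\<close> large takes care of \<open>K\<close>.
\<close>

section \<open>Zeros of prescribed order as factorisations\<close>

text \<open>The factored form survives products and composition with disk automorphisms, which is
  awkward to see from derivatives. One factor \<open>w - l\<close> at a time is divided out by the
  removable singularity theorem; the converse is the Leibniz rule.\<close>

lemma zero_of_order_iff:
  fixes f :: "complex \<Rightarrow> complex"
  assumes "open S" "l \<in> S" and "f holomorphic_on S"
  shows "(\<forall>j<k. (deriv ^^ j) f l = 0) \<longleftrightarrow>
         (\<exists>q. q holomorphic_on S \<and> (\<forall>w\<in>S. f w = (w - l) ^ k * q w))"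
proof
  show "\<exists>q. q holomorphic_on S \<and> (\<forall>w\<in>S. f w = (w - l) ^ k * q w)"
    if "\<forall>j<k. (deriv ^^ j) f l = 0"
    using that assms(3)
  proof (induction k arbitrary: f)
    case 0
    then show ?case by auto
  next
    case (Suc k)
    define g where "g = (\<lambda>z. if z = l then deriv f l else (f z - f l) / (z - l))"
    have g: "g holomorphic_on S"
      unfolding g_def using assms Suc.prems by (intro pole_lemma) (auto simp: interior_open)
    have "f l = 0" using Suc.prems(1)[rule_format, of 0] by simp
    then have fg: "f w = (w - l) * g w" for w
      by (simp add: g_def)
    have "(deriv ^^ j) g l = 0" if "j < k" for j
    proof -
      have "(deriv ^^ Suc j) f l = (deriv ^^ Suc j) (\<lambda>w. (w - l) * g w) l"
        using fg by presburger
      also have "\<dots> = (\<Sum>i = 0..Suc j. of_nat (Suc j choose i) * (deriv ^^ i) (\<lambda>w. (w - l) ^ 1) l * (deriv ^^ (Suc j - i)) g l)"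
      proof -
        have "(\<lambda>w. (w - l) ^ 1) holomorphic_on S" by (intro holomorphic_intros)
        from higher_deriv_mult[OF this g assms(1,2), of "Suc j"] show ?thesis
          unfolding power_one_right .
      qed
      \<comment> \<open>At \<open>l\<close> the linear factor has only its first derivative nonzero,
        so the Leibniz sum reduces to \<open>i = 1\<close>. Writing that factor as a first power
        lets \<open>higher_deriv_power\<close> evaluate its derivatives.\<close>
      also have "\<dots> = (\<Sum>i = 0..Suc j. if i = 1 then of_nat (Suc j) * (deriv ^^ j) g l else 0)"
      proof (intro sum.cong refl)
        fix i :: nat
        consider "i = 0" | "i = 1" | "i \<ge> 2" by linarith
        then show "of_nat (Suc j choose i) * (deriv ^^ i) (\<lambda>w. (w - l) ^ 1) l * (deriv ^^ (Suc j - i)) g l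
          = (if i = 1 then of_nat (Suc j) * (deriv ^^ j) g l else 0)"
          unfolding higher_deriv_power by cases (auto simp: pochhammer_0_left)
      qed
      also have "\<dots> = of_nat (Suc j) * (deriv ^^ j) g l" by (simp del: of_nat_Suc)
      finally have "of_nat (Suc j) * (deriv ^^ j) g l = 0"
        using Suc.prems(1) that by (metis Suc_less_eq)
      then show ?thesis using of_nat_neq_0 mult_eq_0_iff by blast
    qed
    then obtain q where "q holomorphic_on S" "\<forall>w\<in>S. g w = (w - l) ^ k * q w"
      using Suc.IH[OF _ g] by blast
    with fg show ?case by (intro exI[of _ q]) auto
  qed
next
  assume "\<exists>q. q holomorphic_on S \<and> (\<forall>w\<in>S. f w = (w - l) ^ k * q w)"
  then obtain q where q: "q holomorphic_on S" "\<And>w. w\<in>S \<Longrightarrow> f w = (w - l) ^ k * q w"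
    by blast
  show "\<forall>j<k. (deriv ^^ j) f l = 0"
  proof safe
    fix j assume "j < k"
    have "(deriv ^^ j) f l = (deriv ^^ j) (\<lambda>w. (w - l) ^ k * q w) l"
      using assms q by (intro higher_deriv_transform_within_open[of f S]) (auto intro!: holomorphic_intros)
    also have "\<dots> = (\<Sum>i = 0..j. of_nat (j choose i) * (deriv ^^ i) (\<lambda>w. (w - l) ^ k) l * (deriv ^^ (j - i)) q l)"
      using assms q by (intro higher_deriv_mult[where S = S]) (auto intro!: holomorphic_intros)
    \<comment> \<open>Every order \<open>i\<close> here is at most \<open>j < k\<close>, so a
      positive power of \<open>w - l\<close> is left in each term.\<close>
    also have "\<dots> = 0"
      by (intro sum.neutral ballI, subst higher_deriv_power) (use \<open>j < k\<close> in auto)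
    finally show "(deriv ^^ j) f l = 0" .
  qed
qed

section \<open>Weighted modulus, growth space and quotient norms\<close>

definition weighted :: "real \<Rightarrow> (complex \<Rightarrow> complex) \<Rightarrow> complex \<Rightarrow> real" where
  "weighted \<alpha> f z = (1 - (cmod z)\<^sup>2) powr (\<alpha> / 2) * cmod (f z)"

lemma weighted_nonneg: "0 \<le> weighted \<alpha> f z"
  by (simp add: weighted_def)

lemma weighted_triangle: "weighted \<alpha> f z \<le> weighted \<alpha> (\<lambda>z. f z - g z) z + weighted \<alpha> g z"
  unfolding weighted_def distrib_left[symmetric]
  by (intro mult_left_mono) (use norm_triangle_sub[of "f z" "g z"] in auto)

lemma weighted_le_growth_norm:
  "f \<in> growth_space \<alpha> \<Longrightarrow> z \<in> \<D> \<Longrightarrow> weighted \<alpha> f z \<le> growth_norm \<alpha> f"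
  unfolding weighted_def growth_norm_def growth_space_def by (intro cSUP_upper) auto

lemma growth_norm_leI: "(\<And>z. z \<in> \<D> \<Longrightarrow> weighted \<alpha> f z \<le> M) \<Longrightarrow> growth_norm \<alpha> f \<le> M"
  unfolding weighted_def growth_norm_def by (intro cSUP_least) auto

lemma growth_norm_nonneg: "f \<in> growth_space \<alpha> \<Longrightarrow> 0 \<le> growth_norm \<alpha> f"
  using weighted_le_growth_norm[of f \<alpha> 0] weighted_nonneg[of \<alpha> f 0] by simp

lemma growth_spaceI:
  "f holomorphic_on \<D> \<Longrightarrow> (\<And>z. z \<in> \<D> \<Longrightarrow> weighted \<alpha> f z \<le> M) \<Longrightarrow> f \<in> growth_space \<alpha>"
  unfolding growth_space_def weighted_def by (auto intro!: bdd_aboveI2)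

lemma growth_space_holomorphic: "f \<in> growth_space \<alpha> \<Longrightarrow> f holomorphic_on \<D>"
  by (simp add: growth_space_def)

lemma growth_space_diff:
  assumes "f \<in> growth_space \<alpha>" "g \<in> growth_space \<alpha>"
  shows "(\<lambda>z. f z - g z) \<in> growth_space \<alpha>"
proof (rule growth_spaceI)
  show "(\<lambda>z. f z - g z) holomorphic_on \<D>"
    using assms by (intro holomorphic_intros growth_space_holomorphic)
  fix z assume z: "z \<in> \<D>"
  have "weighted \<alpha> (\<lambda>z. f z - g z) z \<le> weighted \<alpha> f z + weighted \<alpha> g z"
    unfolding weighted_def distrib_left[symmetric]
    by (intro mult_left_mono norm_triangle_ineq4) auto
  then show "weighted \<alpha> (\<lambda>z. f z - g z) z \<le> growth_norm \<alpha> f + growth_norm \<alpha> g"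
    using weighted_le_growth_norm[OF assms(1) z] weighted_le_growth_norm[OF assms(2) z] by linarith
qed

lemma vanishing_space_iff:
  assumes "l \<in> \<D>"
  shows "f \<in> vanishing_space \<alpha> l k \<longleftrightarrow> f \<in> growth_space \<alpha> \<and>
           (\<exists>q. q holomorphic_on \<D> \<and> (\<forall>w\<in>\<D>. f w = (w - l) ^ k * q w))"
  unfolding vanishing_space_def using assms zero_of_order_iff[of \<D> l f k]
  by (auto dest: growth_space_holomorphic)

lemma quotient_norm_bdd_below:
  assumes "f \<in> growth_space \<alpha>"
  shows "bdd_below ((\<lambda>g. growth_norm \<alpha> (\<lambda>z. f z - g z)) ` vanishing_space \<alpha> l k)"
  unfolding bdd_below_def
  by (auto intro!: exI[of _ 0] growth_norm_nonneg growth_space_diff assms simp: vanishing_space_def)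

lemma quotient_norm_le:
  assumes "f \<in> growth_space \<alpha>" "g \<in> vanishing_space \<alpha> l k"
  shows "quotient_norm \<alpha> l k f \<le> growth_norm \<alpha> (\<lambda>z. f z - g z)"
  unfolding quotient_norm_def using assms by (intro cINF_lower quotient_norm_bdd_below)

lemma zero_in_vanishing_space: "l \<in> \<D> \<Longrightarrow> (\<lambda>_. 0) \<in> vanishing_space \<alpha> l k"
  by (subst vanishing_space_iff)
     (auto intro!: exI[of _ "\<lambda>_. 0"] growth_spaceI[where M = 0] simp: weighted_def)

lemma quotient_norm_approx:
  assumes "f \<in> growth_space \<alpha>" "l \<in> \<D>" "e > 0"
  obtains g where "g \<in> vanishing_space \<alpha> l k"
    "growth_norm \<alpha> (\<lambda>z. f z - g z) < quotient_norm \<alpha> l k f + e"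
  using cInf_lessD[of "(\<lambda>g. growth_norm \<alpha> (\<lambda>z. f z - g z)) ` vanishing_space \<alpha> l k"
      "quotient_norm \<alpha> l k f + e"] zero_in_vanishing_space[OF assms(2)] assms(3)
  unfolding quotient_norm_def by auto

lemma quotient_norm_le_growth_norm:
  "f \<in> growth_space \<alpha> \<Longrightarrow> l \<in> \<D> \<Longrightarrow> quotient_norm \<alpha> l k f \<le> growth_norm \<alpha> f"
  using quotient_norm_le[OF _ zero_in_vanishing_space] by force

lemma growth_norm_mult_le:
  assumes f: "f \<in> growth_space \<alpha>" and h: "h holomorphic_on \<D>" "\<And>z. z \<in> \<D> \<Longrightarrow> cmod (h z) \<le> 1"
  shows "(\<lambda>z. h z * f z) \<in> growth_space \<alpha>" "growth_norm \<alpha> (\<lambda>z. h z * f z) \<le> growth_norm \<alpha> f"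
proof -
  have *: "weighted \<alpha> (\<lambda>z. h z * f z) z \<le> growth_norm \<alpha> f" if "z \<in> \<D>" for z
  proof -
    have "weighted \<alpha> (\<lambda>z. h z * f z) z = cmod (h z) * weighted \<alpha> f z"
      by (simp add: weighted_def norm_mult)
    also have "\<dots> \<le> weighted \<alpha> f z"
      using h(2)[OF that] by (intro mult_left_le_one_le weighted_nonneg) auto
    finally show ?thesis using weighted_le_growth_norm[OF f that] by linarith
  qed
  show "(\<lambda>z. h z * f z) \<in> growth_space \<alpha>"
    using holomorphic_on_mult[OF h(1) growth_space_holomorphic[OF f]] * by (rule growth_spaceI)
  show "growth_norm \<alpha> (\<lambda>z. h z * f z) \<le> growth_norm \<alpha> f"
    using * by (rule growth_norm_leI)
qed

text \<open>Multiplication by \<open>h\<close> maps the vanishing space into itself and does not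
  increase the growth norm, so a nearly optimal \<open>g\<close> for \<open>f\<close> gives the
  competitor \<open>h * g\<close> for \<open>h * f\<close>.\<close>

lemma quotient_norm_mult_le:
  assumes f: "f \<in> growth_space \<alpha>" and l: "l \<in> \<D>"
    and h: "h holomorphic_on \<D>" "\<And>z. z \<in> \<D> \<Longrightarrow> cmod (h z) \<le> 1"
  shows "quotient_norm \<alpha> l k (\<lambda>z. h z * f z) \<le> quotient_norm \<alpha> l k f"
proof (rule field_le_epsilon)
  fix e :: real assume "e > 0"
  then obtain g where g: "g \<in> vanishing_space \<alpha> l k"
    "growth_norm \<alpha> (\<lambda>z. f z - g z) < quotient_norm \<alpha> l k f + e"
    using quotient_norm_approx[OF f l] by blast
  then obtain q where gs: "g \<in> growth_space \<alpha>" and q: "q holomorphic_on \<D>" "\<And>w. w \<in> \<D> \<Longrightarrow> g w = (w - l) ^ k * q w"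
    using vanishing_space_iff[OF l] by blast
  have "(\<lambda>z. h z * g z) \<in> vanishing_space \<alpha> l k"
    using growth_norm_mult_le[OF gs h] h q unfolding vanishing_space_iff[OF l]
    by (intro conjI exI[of _ "\<lambda>w. h w * q w"]) (auto intro!: holomorphic_intros)
  from quotient_norm_le[OF growth_norm_mult_le(1)[OF f h] this]
  have "quotient_norm \<alpha> l k (\<lambda>z. h z * f z) \<le> growth_norm \<alpha> (\<lambda>z. h z * (f z - g z))"
    by (simp add: right_diff_distrib)
  also have "\<dots> \<le> growth_norm \<alpha> (\<lambda>z. f z - g z)"
    using gs f by (intro growth_norm_mult_le growth_space_diff h)
  finally show "quotient_norm \<alpha> l k (\<lambda>z. h z * f z) \<le> quotient_norm \<alpha> l k f + e"
    using g by simp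
qed

section \<open>Disk involutions\<close>

text \<open>The involutive automorphism of the disk exchanging 0 and \<open>l\<close>; its modulus
  is the pseudohyperbolic distance.\<close>

definition moebius :: "complex \<Rightarrow> complex \<Rightarrow> complex" where
  "moebius l z = (l - z) / (1 - cnj l * z)"

lemma Re_one_minus_cnj_mult:
  assumes "l \<in> \<D>" "z \<in> \<D>"
  shows "Re (1 - cnj l * z) > 0"
proof -
  have "cmod (cnj l * z) < 1"
    using assms mult_strict_mono'[of "cmod l" 1 "cmod z" 1] by (simp add: norm_mult)
  then show ?thesis
    using complex_Re_le_cmod[of "cnj l * z"] by simp
qed

lemma one_minus_cnj_mult_nonzero:
  assumes "l \<in> \<D>" "z \<in> \<D>"
  shows "1 - cnj l * z \<noteq> 0"
  using Re_one_minus_cnj_mult[OF assms] by (metis less_irrefl zero_complex.sel(1))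

lemma one_minus_cmod_square_pos: "z \<in> \<D> \<Longrightarrow> 0 < 1 - (cmod z)\<^sup>2"
  by (simp add: power_less_one_iff abs_square_less_1)

lemma one_minus_moebius_square:
  assumes "l \<in> \<D>" "z \<in> \<D>"
  shows "1 - (cmod (moebius l z))\<^sup>2 = (1 - (cmod l)\<^sup>2) * (1 - (cmod z)\<^sup>2) / (cmod (1 - cnj l * z))\<^sup>2"
proof -
  let ?d = "1 - cnj l * z"
  have "?d \<noteq> 0" using one_minus_cnj_mult_nonzero[OF assms] .
  moreover have "(cmod ?d)\<^sup>2 - (cmod (l - z))\<^sup>2 = (1 - (cmod l)\<^sup>2) * (1 - (cmod z)\<^sup>2)"
    unfolding cmod_power2 by (simp add: power2_eq_square algebra_simps)
  ultimately show ?thesis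
    by (simp add: moebius_def norm_divide field_simps)
qed

lemma moebius_in_disk:
  assumes "l \<in> \<D>" "z \<in> \<D>"
  shows "moebius l z \<in> \<D>"
proof -
  have "0 < 1 - (cmod (moebius l z))\<^sup>2"
    unfolding one_minus_moebius_square[OF assms]
    using assms one_minus_cnj_mult_nonzero[OF assms]
    by (intro divide_pos_pos mult_pos_pos one_minus_cmod_square_pos) auto
  then show ?thesis by (simp add: abs_square_less_1)
qed

text \<open>The explicit factor \<open>z\<close> turns a zero of order m at \<open>l\<close> into
  one of order m at the origin after composition.\<close>

lemma moebius_minus_center:
  assumes "l \<in> \<D>" "z \<in> \<D>"
  shows "moebius l z - l = z * (- of_real (1 - (cmod l)\<^sup>2) / (1 - cnj l * z))"
proof -
  have "(of_real (cmod l))\<^sup>2 = l * cnj l" using complex_norm_square[of l] by simp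
  then show ?thesis
    using one_minus_cnj_mult_nonzero[OF assms] by (simp add: moebius_def field_simps)
qed

lemma one_minus_cnj_moebius_mult:
  assumes "l \<in> \<D>" "z \<in> \<D>" "w \<in> \<D>"
  shows "1 - cnj (moebius l z) * moebius l w =
    of_real (1 - (cmod l)\<^sup>2) * (1 - cnj z * w) / (cnj (1 - cnj l * z) * (1 - cnj l * w))"
proof -
  let ?d = "cnj (1 - cnj l * z) * (1 - cnj l * w)"
  have d: "?d \<noteq> 0"
    using one_minus_cnj_mult_nonzero assms by (metis mult_eq_0_iff complex_cnj_zero_iff)
  have "1 - cnj (moebius l z) * moebius l w = 1 - (cnj l - cnj z) * (l - w) / ?d"
    by (simp add: moebius_def)
  also have "\<dots> = (?d - (cnj l - cnj z) * (l - w)) / ?d"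
    using d by (simp add: diff_divide_distrib del: complex_cnj_diff complex_cnj_mult)
  also have "?d - (cnj l - cnj z) * (l - w) = of_real (1 - (cmod l)\<^sup>2) * (1 - cnj z * w)"
    using complex_norm_square[of l] by (simp add: algebra_simps)
  finally show ?thesis .
qed

lemma moebius_involution:
  assumes "l \<in> \<D>" "z \<in> \<D>"
  shows "moebius l (moebius l z) = z"
proof -
  have d: "1 - cnj l * z \<noteq> 0" "1 - cnj l * moebius l z \<noteq> 0"
    using one_minus_cnj_mult_nonzero assms moebius_in_disk by blast+
  have "l - moebius l z = z * (1 - cnj l * moebius l z)"
    using d(1) by (simp add: moebius_def field_simps)
  then show ?thesis using d(2) by (simp add: moebius_def[of l "moebius l z"])
qed

text \<open>Invariance of the pseudohyperbolic distance under an involution. The form 1 minus the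
  square is a product of three factors by \<open>one_minus_moebius_square\<close>, and everything
  depending on \<open>l\<close> cancels. It is also the quantity in
  \<open>weighted_kern\<close>.\<close>

lemma cmod_moebius_moebius:
  assumes "l \<in> \<D>" "z \<in> \<D>" "w \<in> \<D>"
  shows "1 - (cmod (moebius (moebius l z) (moebius l w)))\<^sup>2 = 1 - (cmod (moebius z w))\<^sup>2"
proof -
  let ?A = "cmod (1 - cnj l * z)" and ?B = "cmod (1 - cnj l * w)" and ?C = "cmod (1 - cnj z * w)"
  let ?l = "1 - (cmod l)\<^sup>2"
  have nz: "?A \<noteq> 0" "?B \<noteq> 0" "?C \<noteq> 0" "?l > 0"
    using one_minus_cnj_mult_nonzero assms one_minus_cmod_square_pos by auto
  have "cmod (1 - cnj (moebius l z) * moebius l w) = ?l * ?C / (?A * ?B)"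
    unfolding one_minus_cnj_moebius_mult[OF assms] norm_mult norm_divide complex_mod_cnj norm_of_real
    using nz by simp
  then have "1 - (cmod (moebius (moebius l z) (moebius l w)))\<^sup>2 =
      (?l * (1 - (cmod z)\<^sup>2) / ?A\<^sup>2) * (?l * (1 - (cmod w)\<^sup>2) / ?B\<^sup>2) / (?l * ?C / (?A * ?B))\<^sup>2"
    by (simp only: one_minus_moebius_square moebius_in_disk assms)
  also have "\<dots> = (1 - (cmod z)\<^sup>2) * (1 - (cmod w)\<^sup>2) / ?C\<^sup>2"
    using nz by (simp add: power2_eq_square)
  finally show ?thesis unfolding one_minus_moebius_square[OF assms(2,3)] .
qed

lemma moebius_holomorphic [holomorphic_intros]:
  assumes "l \<in> \<D>" shows "moebius l holomorphic_on \<D>"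
proof -
  have "(\<lambda>z. (l - z) / (1 - cnj l * z)) holomorphic_on \<D>"
    using one_minus_cnj_mult_nonzero[OF assms] by (intro holomorphic_intros) auto
  then show ?thesis by (simp add: moebius_def[abs_def])
qed

section \<open>Kernels and weighted composition\<close>

text \<open>Its modulus is the modulus of the derivative of \<open>moebius l\<close> to the power
  \<open>\<alpha> / 2\<close>, which is the factor that makes composition with
  \<open>moebius l\<close> preserve the weighted modulus. The principal branch is holomorphic
  because the base has positive real part.\<close>

definition kern :: "real \<Rightarrow> complex \<Rightarrow> complex \<Rightarrow> complex" where
  "kern \<alpha> l w = of_real ((1 - (cmod l)\<^sup>2) powr (\<alpha> / 2)) * (1 - cnj l * w) powr (- of_real \<alpha>)"

lemma kern_holomorphic [holomorphic_intros]:
  assumes "l \<in> \<D>" shows "kern \<alpha> l holomorphic_on \<D>"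
proof -
  have "(\<lambda>w. of_real ((1 - (cmod l)\<^sup>2) powr (\<alpha> / 2)) * (1 - cnj l * w) powr (- of_real \<alpha>)) holomorphic_on \<D>"
    using Re_one_minus_cnj_mult[OF assms]
    by (intro holomorphic_intros) (auto simp: complex_nonpos_Reals_iff not_le)
  then show ?thesis by (simp add: kern_def[abs_def])
qed

lemma kern_nonzero: "l \<in> \<D> \<Longrightarrow> w \<in> \<D> \<Longrightarrow> kern \<alpha> l w \<noteq> 0"
  using one_minus_cnj_mult_nonzero[of l w] one_minus_cmod_square_pos[of l] by (simp add: kern_def)

lemma weighted_kern:
  assumes "l \<in> \<D>" "w \<in> \<D>"
  shows "weighted \<alpha> (kern \<alpha> l) w = (1 - (cmod (moebius l w))\<^sup>2) powr (\<alpha> / 2)"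
proof -
  let ?B = "cmod (1 - cnj l * w)"
  have nz: "?B > 0" "1 - (cmod l)\<^sup>2 > 0" "1 - (cmod w)\<^sup>2 > 0"
    using one_minus_cnj_mult_nonzero assms one_minus_cmod_square_pos by auto
  have "cmod ((1 - cnj l * w) powr (- of_real \<alpha>)) = ?B powr (- \<alpha>)"
    by (subst norm_powr_real_powr') auto
  also have "?B powr (- \<alpha>) = 1 / ?B powr \<alpha>"
    by (rule powr_minus_divide)
  also have "?B powr \<alpha> = (?B powr 2) powr (\<alpha> / 2)"
    unfolding powr_powr by simp
  also have "?B powr 2 = ?B\<^sup>2"
    using nz by simp
  finally show ?thesis
    unfolding one_minus_moebius_square[OF assms] using nz
    by (simp add: weighted_def kern_def norm_mult powr_mult powr_divide)
qed

definition transport :: "real \<Rightarrow> complex \<Rightarrow> (complex \<Rightarrow> complex) \<Rightarrow> complex \<Rightarrow> complex" where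
  "transport \<alpha> l f w = f (moebius l w) * kern \<alpha> l w"

lemma transport_holomorphic:
  assumes "l \<in> \<D>" "f holomorphic_on \<D>" shows "transport \<alpha> l f holomorphic_on \<D>"
proof -
  have "(f \<circ> moebius l) holomorphic_on \<D>"
    using assms moebius_in_disk by (intro holomorphic_on_compose_gen[OF moebius_holomorphic]) auto
  then have "(\<lambda>w. (f \<circ> moebius l) w * kern \<alpha> l w) holomorphic_on \<D>"
    using assms by (intro holomorphic_on_mult kern_holomorphic)
  then show ?thesis by (simp add: transport_def[abs_def])
qed

lemma weighted_transport:
  assumes "l \<in> \<D>" "w \<in> \<D>"
  shows "weighted \<alpha> (transport \<alpha> l f) w = weighted \<alpha> f (moebius l w)"
proof -
  have "weighted \<alpha> (transport \<alpha> l f) w = cmod (f (moebius l w)) * weighted \<alpha> (kern \<alpha> l) w"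
    by (simp add: weighted_def transport_def norm_mult)
  also have "\<dots> = weighted \<alpha> f (moebius l w)"
    unfolding weighted_kern[OF assms] by (simp add: weighted_def)
  finally show ?thesis .
qed

text \<open>The quotient of the two functions has modulus 1 throughout, so it attains its maximum
  modulus at the interior point 0 and is constant.\<close>

lemma holomorphic_eq_unimodular_mult:
  assumes "f holomorphic_on \<D>" "g holomorphic_on \<D>"
    and g: "\<And>z. z \<in> \<D> \<Longrightarrow> g z \<noteq> 0" and eq: "\<And>z. z \<in> \<D> \<Longrightarrow> cmod (f z) = cmod (g z)"
  obtains c where "cmod c = 1" "\<And>z. z \<in> \<D> \<Longrightarrow> f z = c * g z"
proof -
  have n: "cmod (f z / g z) = 1" if "z \<in> \<D>" for z
    using g[OF that] eq[OF that] by (simp add: norm_divide)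
  have "(\<lambda>z. f z / g z) constant_on \<D>"
  proof (rule maximum_modulus_principle[where U = \<D> and \<xi> = 0])
    show "(\<lambda>z. f z / g z) holomorphic_on \<D>"
      using assms by (intro holomorphic_intros) auto
    show "\<And>z. z \<in> \<D> \<Longrightarrow> cmod (f z / g z) \<le> cmod (f 0 / g 0)"
      using n n[of 0] by simp
  qed auto
  then obtain c where c: "\<And>z. z \<in> \<D> \<Longrightarrow> f z / g z = c"
    unfolding constant_on_def by blast
  show thesis
  proof (rule that)
    show "cmod c = 1" using n[of 0] c[of 0] by simp
    show "f z = c * g z" if "z \<in> \<D>" for z using c[OF that] g[OF that] by (simp add: field_simps)
  qed
qed

text \<open>Both functions have the same weighted modulus by invariance of the pseudohyperbolic
  distance, and neither vanishes. Comparing moduli avoids any calculation with branches of complex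
  powers.\<close>

lemma kern_eq_transport:
  assumes "l \<in> \<D>" "z \<in> \<D>"
  obtains c where "cmod c = 1"
    "\<And>w. w \<in> \<D> \<Longrightarrow> kern \<alpha> z w = c * transport \<alpha> l (kern \<alpha> (moebius l z)) w"
proof (rule holomorphic_eq_unimodular_mult)
  note a = moebius_in_disk[OF assms]
  show "kern \<alpha> z holomorphic_on \<D>" "transport \<alpha> l (kern \<alpha> (moebius l z)) holomorphic_on \<D>"
    using assms a by (blast intro: kern_holomorphic transport_holomorphic)+
  fix w assume w: "w \<in> \<D>"
  note b = moebius_in_disk[OF assms(1) w]
  show "transport \<alpha> l (kern \<alpha> (moebius l z)) w \<noteq> 0"
    using assms(1) w a b kern_nonzero by (simp add: transport_def)
  have "weighted \<alpha> (kern \<alpha> z) w = weighted \<alpha> (transport \<alpha> l (kern \<alpha> (moebius l z))) w"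
    by (simp only: weighted_kern weighted_transport assms w a b cmod_moebius_moebius)
  then show "cmod (kern \<alpha> z w) = cmod (transport \<alpha> l (kern \<alpha> (moebius l z)) w)"
    using one_minus_cmod_square_pos[OF w] by (simp add: weighted_def)
qed (use that in blast)

section \<open>Decay near a zero of high order\<close>

lemma maximum_modulus_disk:
  assumes "f holomorphic_on \<D>" "0 < s" "s < 1" and B: "\<And>u. cmod u = s \<Longrightarrow> cmod (f u) \<le> B"
    and "cmod w \<le> s"
  shows "cmod (f w) \<le> B"
proof (rule maximum_modulus_frontier[where f = f and S = "cball 0 s" and \<xi> = w])
  show "f holomorphic_on interior (cball 0 s)"
    using assms by (intro holomorphic_on_subset[OF assms(1)]) auto
  show "continuous_on (closure (cball 0 s)) f"
    using assms by (intro continuous_on_subset[OF holomorphic_on_imp_continuous_on[OF assms(1)]]) auto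
qed (use assms in auto)

text \<open>For positive arguments this is
  \<open>(1 + C / \<alpha>) powr (\<alpha> / 2) * exp (- C / 2)\<close>, a bound independent of the
  multiplicity for the ratio of the profile
  \<open>t ^ m * (1 - t\<^sup>2) powr (\<alpha> / 2)\<close> at the squared radius
  \<open>(m - C) / (m + \<alpha>)\<close> to its maximum.\<close>

definition decay :: "real \<Rightarrow> real \<Rightarrow> real" where
  "decay \<alpha> C = exp ((\<alpha> * ln (1 + C / \<alpha>) - C) / 2)"

lemma decay_less_1:
  assumes "\<alpha> > 0" "C > 0" shows "decay \<alpha> C < 1"
proof -
  have "\<alpha> * ln (1 + C / \<alpha>) < \<alpha> * (C / \<alpha>)"
    using assms by (intro mult_strict_left_mono ln_add_one_self_less_self) auto
  then show ?thesis using assms by (simp add: decay_def)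
qed

text \<open>Needed for points strictly inside the critical radius, which correspond to a larger
  constant. Factoring \<open>1 + C' / \<alpha>\<close> splits the logarithm, and the increment is
  controlled by ln (1 + x) \<le> x.\<close>

lemma decay_antimono:
  assumes "\<alpha> > 0" "0 < C" "C \<le> C'" shows "decay \<alpha> C' \<le> decay \<alpha> C"
proof -
  have "1 + C' / \<alpha> = (1 + C / \<alpha>) * (1 + (C' - C) / (\<alpha> + C))"
  proof -
    have eqs: "1 + (C' - C) / (\<alpha> + C) = (\<alpha> + C') / (\<alpha> + C)"
      "1 + C / \<alpha> = (\<alpha> + C) / \<alpha>" "1 + C' / \<alpha> = (\<alpha> + C') / \<alpha>"
      using assms by (simp_all add: field_simps)
    show ?thesis unfolding eqs using assms by simp
  qed
  then have "ln (1 + C' / \<alpha>) = ln (1 + C / \<alpha>) + ln (1 + (C' - C) / (\<alpha> + C))"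
    using assms ln_mult_pos[of "1 + C / \<alpha>" "1 + (C' - C) / (\<alpha> + C)"]
    by (simp add: add_pos_nonneg)
  also have "ln (1 + (C' - C) / (\<alpha> + C)) \<le> (C' - C) / (\<alpha> + C)"
    using assms by (intro ln_add_one_self_le_self) auto
  also have "\<dots> \<le> (C' - C) / \<alpha>"
    using assms by (intro divide_left_mono) auto
  finally have "\<alpha> * ln (1 + C' / \<alpha>) \<le> \<alpha> * (ln (1 + C / \<alpha>) + (C' - C) / \<alpha>)"
    using assms by (intro mult_left_mono) auto
  then show ?thesis using assms by (simp add: decay_def distrib_left)
qed

text \<open>The proof uses the radius \<open>s\<close> that maximises \<open>s ^ m * (1 - s\<^sup>2) powr (\<alpha> / 2)\<close>
  and applies the maximum principle there to \<open>G w / w ^ m\<close>.\<close>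

lemma weighted_le_decay:
  fixes m :: nat
  assumes \<alpha>: "\<alpha> > 0" and C: "0 < C" "C < real m" and Q: "Q holomorphic_on \<D>"
    and GQ: "\<And>w. w \<in> \<D> \<Longrightarrow> G w = w ^ m * Q w" and M: "\<And>w. w \<in> \<D> \<Longrightarrow> weighted \<alpha> G w \<le> M"
    and w: "w \<in> \<D>" "(cmod w)\<^sup>2 \<le> (real m - C) / (real m + \<alpha>)"
  shows "weighted \<alpha> G w \<le> decay \<alpha> C * M"
proof -
  define s where "s = sqrt (real m / (real m + \<alpha>))"
  have s: "0 < s" "s < 1" and s2: "s\<^sup>2 = real m / (real m + \<alpha>)"
    using \<alpha> C by (simp_all add: s_def)
  have s': "1 - s\<^sup>2 = \<alpha> / (real m + \<alpha>)" using \<alpha> C by (simp add: s2 field_simps)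
  have s'': "1 - s\<^sup>2 > 0" unfolding s' using \<alpha> C by simp
  have M0: "M \<ge> 0" using M[of 0] weighted_nonneg[of \<alpha> G 0] by simp
  define t where "t = (cmod w)\<^sup>2"
  \<comment> \<open>The value for which the squared modulus \<open>t\<close> of \<open>w\<close>
    equals \<open>(m - C') / (m + \<alpha>)\<close> exactly; the estimate is proved with
    \<open>C'\<close> and then weakened to \<open>C\<close>.\<close>
  define C' where "C' = real m - t * (real m + \<alpha>)"
  have C': "C \<le> C'" using w(2) \<alpha> C by (simp add: C'_def t_def field_simps)
  have "cmod (Q w) \<le> M / ((1 - s\<^sup>2) powr (\<alpha> / 2) * s ^ m)"
  proof (rule maximum_modulus_disk[OF Q s])
    fix u assume u: "cmod u = s"
    then have "weighted \<alpha> G u \<le> M" "G u = u ^ m * Q u" using s GQ M by auto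
    then have "cmod (Q u) * ((1 - s\<^sup>2) powr (\<alpha> / 2) * s ^ m) \<le> M"
      using u by (simp add: weighted_def norm_mult norm_power mult_ac)
    then show "cmod (Q u) \<le> M / ((1 - s\<^sup>2) powr (\<alpha> / 2) * s ^ m)"
      using s s'' by (subst pos_le_divide_eq) auto
  next
    have "(real m - C) / (real m + \<alpha>) \<le> real m / (real m + \<alpha>)"
      using \<alpha> C by (intro divide_right_mono) auto
    then have "(cmod w)\<^sup>2 \<le> s\<^sup>2" unfolding s2 using w(2) by linarith
    then show "cmod w \<le> s" by (rule power2_le_imp_le) (use s in simp)
  qed
  then have "weighted \<alpha> G w \<le> (1 - t) powr (\<alpha> / 2) * ((cmod w) ^ m * (M / ((1 - s\<^sup>2) powr (\<alpha> / 2) * s ^ m)))"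
    unfolding weighted_def t_def GQ[OF w(1)] norm_mult norm_power by (intro mult_left_mono) auto
  also have "\<dots> = ((1 - t) / (1 - s\<^sup>2)) powr (\<alpha> / 2) * (cmod w / s) ^ m * M"
    using s s'' one_minus_cmod_square_pos[OF w(1)] by (simp add: t_def powr_divide power_divide)
  also have "(1 - t) / (1 - s\<^sup>2) = 1 + C' / \<alpha>"
    using \<alpha> C unfolding s' C'_def by (simp add: field_simps)
  also have "(1 + C' / \<alpha>) powr (\<alpha> / 2) * (cmod w / s) ^ m * M \<le> (1 + C' / \<alpha>) powr (\<alpha> / 2) * exp (- C' / 2) * M"
  proof (intro mult_right_mono mult_left_mono M0)
    \<comment> \<open>The inequality 1 + x \<le> exp x removes the dependence on \<open>m\<close>:
      raising the square root to the power \<open>m\<close> leaves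
      \<open>exp (- C' / 2)\<close>.\<close>
    have "(cmod w / s)\<^sup>2 = 1 + - C' / m"
      using \<alpha> C s by (simp add: s2 C'_def field_simps flip: t_def)
    also have "\<dots> \<le> exp (- C' / m)" by (rule exp_ge_add_one_self)
    also have "\<dots> = (exp (- C' / (2 * m)))\<^sup>2" by (simp flip: exp_double)
    finally have "cmod w / s \<le> exp (- C' / (2 * m))" by (rule power2_le_imp_le) simp
    then have "(cmod w / s) ^ m \<le> exp (- C' / (2 * m)) ^ m"
      using s by (intro power_mono) auto
    also have "\<dots> = exp (- C' / 2)" using C by (simp flip: exp_of_nat_mult)
    finally show "(cmod w / s) ^ m \<le> exp (- C' / 2)" .
  qed simp
  also have "(1 + C' / \<alpha>) powr (\<alpha> / 2) * exp (- C' / 2) = decay \<alpha> C'"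
  proof -
    have "1 + C' / \<alpha> > 0" using C C' \<alpha> by (simp add: add_pos_nonneg)
    then have "(1 + C' / \<alpha>) powr (\<alpha> / 2) = exp (\<alpha> / 2 * ln (1 + C' / \<alpha>))"
      by (simp add: powr_def)
    then show ?thesis
      by (simp add: decay_def diff_divide_distrib flip: exp_add)
  qed
  also have "decay \<alpha> C' * M \<le> decay \<alpha> C * M"
    using decay_antimono[OF \<alpha> C(1) C'] M0 by (rule mult_right_mono)
  finally show ?thesis .
qed

text \<open>A nearly optimal \<open>g\<close> in the vanishing space is moved to the origin, where
  \<open>weighted_le_decay\<close> applies, and \<open>f\<close> is recovered as \<open>g\<close>
  plus a small difference.\<close>

lemma weighted_le_quotient_norm:
  fixes m :: nat
  assumes \<alpha>: "\<alpha> > 0" and C: "0 < C" "C < real m" and f: "f \<in> growth_space \<alpha>" and l: "l \<in> \<D>"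
    and z: "z \<in> pseudohyperbolic_disk l (sqrt ((real m - C) / (real m + \<alpha>)))"
  shows "weighted \<alpha> f z \<le> decay \<alpha> C * growth_norm \<alpha> f + 2 * quotient_norm \<alpha> l m f"
proof (rule field_le_epsilon)
  fix e :: real assume "e > 0"
  then obtain g where "g \<in> vanishing_space \<alpha> l m"
    and gn: "growth_norm \<alpha> (\<lambda>z. f z - g z) < quotient_norm \<alpha> l m f + e / 2"
    using quotient_norm_approx[OF f l, of "e / 2"] by auto
  then obtain q where g: "g \<in> growth_space \<alpha>" and q: "q holomorphic_on \<D>" "\<And>w. w \<in> \<D> \<Longrightarrow> g w = (w - l) ^ m * q w"
    using vanishing_space_iff[OF l] by blast
  have zD: "z \<in> \<D>" and zl: "cmod (moebius l z) < sqrt ((real m - C) / (real m + \<alpha>))"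
    using z by (auto simp: pseudohyperbolic_disk_def moebius_def)
  note fg = growth_space_diff[OF f g]
  define E where "E = growth_norm \<alpha> (\<lambda>z. f z - g z)"
  have E: "E \<ge> 0" unfolding E_def by (rule growth_norm_nonneg[OF fg])
  have gM: "weighted \<alpha> g w \<le> growth_norm \<alpha> f + E" if "w \<in> \<D>" for w
  proof -
    have "weighted \<alpha> g w \<le> weighted \<alpha> (\<lambda>z. f z - g z) w + weighted \<alpha> f w"
      using weighted_triangle[of \<alpha> g w f] by (simp add: weighted_def norm_minus_commute)
    also have "\<dots> \<le> E + growth_norm \<alpha> f"
      unfolding E_def using that f fg by (intro add_mono weighted_le_growth_norm)
    finally show ?thesis by simp
  qed
  have "weighted \<alpha> (transport \<alpha> l g) (moebius l z) \<le> decay \<alpha> C * (growth_norm \<alpha> f + E)"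
  proof (rule weighted_le_decay[OF \<alpha> C])
    \<comment> \<open>The m-th power comes from \<open>moebius_minus_center\<close>: composing
      \<open>(w - l) ^ m\<close> with the involution gives \<open>w ^ m\<close> times that
      power.\<close>
    let ?Q = "\<lambda>w. (- of_real (1 - (cmod l)\<^sup>2) / (1 - cnj l * w)) ^ m * transport \<alpha> l q w"
    show "?Q holomorphic_on \<D>"
      using one_minus_cnj_mult_nonzero[OF l] l q
      by (intro holomorphic_on_mult holomorphic_intros transport_holomorphic) auto
    show "transport \<alpha> l g w = w ^ m * ?Q w" if "w \<in> \<D>" for w
      unfolding transport_def q(2)[OF moebius_in_disk[OF l that]] moebius_minus_center[OF l that]
      by (simp only: power_mult_distrib mult.assoc)
    show "weighted \<alpha> (transport \<alpha> l g) w \<le> growth_norm \<alpha> f + E" if "w \<in> \<D>" for w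
      using gM l that by (simp only: weighted_transport moebius_in_disk)
    show "moebius l z \<in> \<D>" using l zD by (rule moebius_in_disk)
    show "(cmod (moebius l z))\<^sup>2 \<le> (real m - C) / (real m + \<alpha>)"
      using zl \<alpha> C by (intro sqrt_ge_absD) auto
  qed
  then have "weighted \<alpha> g z \<le> decay \<alpha> C * (growth_norm \<alpha> f + E)"
    by (simp only: weighted_transport moebius_in_disk moebius_involution l zD)
  moreover have "weighted \<alpha> f z \<le> E + weighted \<alpha> g z"
    using weighted_triangle[of \<alpha> f z g] weighted_le_growth_norm[OF fg zD] by (simp add: E_def)
  \<comment> \<open>The error \<open>E\<close> enters once as the norm of \<open>f - g\<close> and
    once through the bound on \<open>g\<close>. This controls the second occurrence, which explains
    the factor 2 and the choice of \<open>e / 2\<close>.\<close>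
  moreover have "decay \<alpha> C * E \<le> E"
    using decay_less_1[OF \<alpha> C(1)] E by (intro mult_left_le_one_le) (auto simp: decay_def)
  ultimately show "weighted \<alpha> f z \<le> decay \<alpha> C * growth_norm \<alpha> f + 2 * quotient_norm \<alpha> l m f + e"
    using gn unfolding E_def[symmetric] by (simp add: distrib_left)
qed

section \<open>Sufficiency of the covering condition\<close>

text \<open>Removing the factor \<open>w ^ n\<close> costs only a constant. Where
  \<open>cmod z \<ge> R\<close> the factor is at least \<open>R ^ n\<close>; elsewhere the maximum
  principle bounds \<open>f\<close> by its values on the circle of radius \<open>R\<close>, and the
  weight at \<open>z\<close> is at most 1.\<close>

lemma weighted_le_growth_norm_power_mult:
  assumes f: "f \<in> growth_space \<alpha>" and R: "0 < R" "R < 1" and \<alpha>: "\<alpha> > 0" and z: "z \<in> \<D>"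
  shows "(1 - R\<^sup>2) powr (\<alpha> / 2) * R ^ n * weighted \<alpha> f z \<le> growth_norm \<alpha> (\<lambda>w. w ^ n * f w)"
    (is "?k * _ * _ \<le> ?N")
proof -
  have fn: "(\<lambda>w. w ^ n * f w) \<in> growth_space \<alpha>"
    by (intro growth_norm_mult_le[OF f]) (auto intro!: holomorphic_intros simp: norm_power power_le_one)
  have R2: "0 < 1 - R\<^sup>2" using R by (simp add: power_less_one_iff)
  have k: "0 < ?k" "?k \<le> 1" using R2 \<alpha> by (auto intro!: powr_le1)
  have eq: "weighted \<alpha> (\<lambda>w. w ^ n * f w) z = cmod z ^ n * weighted \<alpha> f z" for z
    by (simp add: weighted_def norm_mult norm_power)
  show ?thesis
  proof (cases "R \<le> cmod z")
    case True
    have "?k * R ^ n * weighted \<alpha> f z \<le> 1 * cmod z ^ n * weighted \<alpha> f z"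
      using k R True by (intro mult_right_mono mult_mono weighted_nonneg power_mono) auto
    then show ?thesis using weighted_le_growth_norm[OF fn z] unfolding eq by simp
  next
    case False
    have "cmod (f z) \<le> ?N / (?k * R ^ n)"
    proof (rule maximum_modulus_disk[OF growth_space_holomorphic[OF f] R])
      fix u assume u: "cmod u = R"
      then have "weighted \<alpha> (\<lambda>w. w ^ n * f w) u \<le> ?N"
        using R by (intro weighted_le_growth_norm[OF fn]) auto
      then have "cmod (f u) * (?k * R ^ n) \<le> ?N"
        using u by (simp add: weighted_def norm_mult norm_power mult_ac)
      then show "cmod (f u) \<le> ?N / (?k * R ^ n)"
        using k R by (subst pos_le_divide_eq) auto
    qed (use False in simp)
    moreover have "weighted \<alpha> f z \<le> cmod (f z)"
      unfolding weighted_def using \<alpha> one_minus_cmod_square_pos[OF z]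
      by (intro mult_left_le_one_le powr_le1) auto
    ultimately have "weighted \<alpha> f z \<le> ?N / (?k * R ^ n)" by linarith
    then show ?thesis using k R by (subst (asm) pos_le_divide_eq) (auto simp: mult_ac)
  qed
qed

lemma bdd_above_quotient_norms:
  assumes "f \<in> growth_space \<alpha>" "\<Lambda> \<subseteq> \<D>"
  shows "bdd_above (insert 0 ((\<lambda>l. quotient_norm \<alpha> l (m l) f) ` \<Lambda>))"
  using assms quotient_norm_le_growth_norm[OF assms(1)]
  by (auto intro!: bdd_aboveI2[of _ _ "growth_norm \<alpha> f"])

text \<open>Multiplication by \<open>z ^ n\<close> does not increase the quotient norms, but makes \<open>f\<close> negligible on \<open>K\<close>.\<close>

lemma sampling_divisor_if_covering:
  assumes \<alpha>: "\<alpha> > 0" and \<Lambda>: "\<Lambda> \<subseteq> \<D>" and C: "C > 0" and K: "compact K" "K \<subseteq> \<D>"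
    and cover: "\<D> - K \<subseteq> (\<Union>l\<in>{l\<in>\<Lambda>. real (m l) > C}.
      pseudohyperbolic_disk l (sqrt ((real (m l) - C) / (real (m l) + \<alpha>))))"
  shows "sampling_divisor \<alpha> \<Lambda> m"
proof -
  obtain r where r: "0 \<le> r" "r < 1" "\<And>z. z \<in> K \<Longrightarrow> cmod z \<le> r"
  proof (cases "K = {}")
    case True
    then show ?thesis using that[of 0] by simp
  next
    case False
    from continuous_attains_sup[OF K(1) False continuous_on_norm_id]
    obtain x where "x \<in> K" "\<forall>y\<in>K. cmod y \<le> cmod x" by auto
    then show ?thesis using that[of "cmod x"] K by auto
  qed
  \<comment> \<open>A radius strictly between \<open>r\<close> and 1: powers of \<open>r / R\<close>
    tend to 0, so some \<open>n\<close> makes the factor \<open>r ^ n\<close> on \<open>K\<close>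
    smaller than the loss \<open>\<kappa> * R ^ n\<close>.\<close>
  define R where "R = (1 + r) / 2"
  have R: "0 < R" "R < 1" "r < R" using r by (auto simp: R_def)
  define \<kappa> where "\<kappa> = (1 - R\<^sup>2) powr (\<alpha> / 2)"
  have "1 - R\<^sup>2 > 0" using R by (simp add: power_less_one_iff)
  then have \<kappa>: "\<kappa> > 0" by (simp add: \<kappa>_def)
  obtain n where "(r / R) ^ n < \<kappa>"
    using real_arch_pow_inv[OF \<kappa>, of "r / R"] R by auto
  then have n: "r ^ n < \<kappa> * R ^ n" using R by (simp add: field_simps)
  define \<eta> where "\<eta> = decay \<alpha> C"
  have \<eta>: "\<eta> < 1" unfolding \<eta>_def by (rule decay_less_1[OF \<alpha> C])
  \<comment> \<open>Obtained by chaining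
    \<open>\<kappa> * R ^ n * growth_norm \<alpha> f \<le> N\<close> with
    \<open>(1 - \<eta>) * N \<le> 2 * \<delta>\<close>.\<close>
  define L where "L = 2 / ((1 - \<eta>) * (\<kappa> * R ^ n))"
  have L: "L > 0" unfolding L_def using \<eta> \<kappa> R by simp
  have "growth_norm \<alpha> f \<le> L * Sup (insert 0 ((\<lambda>l. quotient_norm \<alpha> l (m l) f) ` \<Lambda>))"
    if f: "f \<in> growth_space \<alpha>" for f
  proof -
    define \<delta> where "\<delta> = Sup (insert 0 ((\<lambda>l. quotient_norm \<alpha> l (m l) f) ` \<Lambda>))"
    have bdd: "bdd_above (insert 0 ((\<lambda>l. quotient_norm \<alpha> l (m l) f) ` \<Lambda>))"
      using f \<Lambda> by (rule bdd_above_quotient_norms)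
    have \<delta>0: "\<delta> \<ge> 0" unfolding \<delta>_def using bdd by (intro cSup_upper) auto
    have \<delta>: "quotient_norm \<alpha> l (m l) f \<le> \<delta>" if "l \<in> \<Lambda>" for l
      unfolding \<delta>_def using that bdd by (intro cSup_upper) auto
    define h where "h = (\<lambda>w::complex. w ^ n)"
    have h: "h holomorphic_on \<D>" "\<And>w. w \<in> \<D> \<Longrightarrow> cmod (h w) \<le> 1"
      by (auto simp: h_def norm_power power_le_one intro!: holomorphic_intros)
    define N where "N = growth_norm \<alpha> (\<lambda>w. h w * f w)"
    have low: "\<kappa> * R ^ n * growth_norm \<alpha> f \<le> N"
    proof -
      have "weighted \<alpha> f z \<le> N / (\<kappa> * R ^ n)" if "z \<in> \<D>" for z
        using weighted_le_growth_norm_power_mult[OF f R(1,2) \<alpha> that, of n] \<kappa> R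
        by (subst pos_le_divide_eq) (auto simp: N_def h_def \<kappa>_def mult_ac)
      then have "growth_norm \<alpha> f \<le> N / (\<kappa> * R ^ n)" by (rule growth_norm_leI)
      then show ?thesis using \<kappa> R by (simp add: field_simps)
    qed
    have up: "N \<le> max (r ^ n * growth_norm \<alpha> f) (\<eta> * N + 2 * \<delta>)"
      unfolding N_def
    proof (rule growth_norm_leI, fold N_def)
      fix z assume z: "z \<in> \<D>"
      show "weighted \<alpha> (\<lambda>w. h w * f w) z \<le> max (r ^ n * growth_norm \<alpha> f) (\<eta> * N + 2 * \<delta>)"
      proof (cases "z \<in> K")
        case True
        have "weighted \<alpha> (\<lambda>w. h w * f w) z = cmod z ^ n * weighted \<alpha> f z"
          by (simp add: weighted_def h_def norm_mult norm_power)
        also have "\<dots> \<le> r ^ n * growth_norm \<alpha> f"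
          using r(1) r(3)[OF True] weighted_le_growth_norm[OF f z]
          by (intro mult_mono power_mono weighted_nonneg) auto
        finally show ?thesis by simp
      next
        case False
        then obtain l where l: "l \<in> \<Lambda>" "real (m l) > C"
          "z \<in> pseudohyperbolic_disk l (sqrt ((real (m l) - C) / (real (m l) + \<alpha>)))"
          using cover z by blast
        then have lD: "l \<in> \<D>" using \<Lambda> by blast
        have "weighted \<alpha> (\<lambda>w. h w * f w) z \<le> \<eta> * N + 2 * quotient_norm \<alpha> l (m l) (\<lambda>w. h w * f w)"
          unfolding \<eta>_def N_def
          by (intro weighted_le_quotient_norm[OF \<alpha> C] l lD growth_norm_mult_le[OF f] h)
        moreover have "quotient_norm \<alpha> l (m l) (\<lambda>w. h w * f w) \<le> \<delta>"
          using quotient_norm_mult_le[OF f lD h] \<delta>[OF l(1)] by (meson order_trans)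
        ultimately show ?thesis by simp
      qed
    qed
    show ?thesis
    proof (cases "N \<le> r ^ n * growth_norm \<alpha> f")
      case True
      \<comment> \<open>If the bound on \<open>K\<close> dominates, the lower bound for
        \<open>N\<close> and the choice of \<open>n\<close> are incompatible with a positive
        norm.\<close>
      have "growth_norm \<alpha> f \<le> 0"
      proof (rule ccontr)
        assume "\<not> ?thesis"
        then have "r ^ n * growth_norm \<alpha> f < \<kappa> * R ^ n * growth_norm \<alpha> f"
          using n by (intro mult_strict_right_mono) auto
        then show False using True low by linarith
      qed
      also have "0 \<le> L * \<delta>" using L \<delta>0 by simp
      finally show ?thesis unfolding \<delta>_def .
    next
      case False
      then have "(1 - \<eta>) * N \<le> 2 * \<delta>" using up by (simp add: algebra_simps)
      moreover have "(1 - \<eta>) * (\<kappa> * R ^ n * growth_norm \<alpha> f) \<le> (1 - \<eta>) * N"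
        using low \<eta> by (intro mult_left_mono) auto
      ultimately have "(1 - \<eta>) * (\<kappa> * R ^ n * growth_norm \<alpha> f) \<le> 2 * \<delta>" by linarith
      then have "growth_norm \<alpha> f \<le> L * \<delta>"
        unfolding L_def using \<eta> \<kappa> R by (simp add: field_simps)
      then show ?thesis unfolding \<delta>_def .
    qed
  qed
  then show ?thesis unfolding sampling_divisor_def using L by blast
qed

section \<open>Taylor polynomials of the kernel\<close>

text \<open>The cofactor is the series with indices shifted by \<open>m\<close>. Away from 0 it
  converges because its product with \<open>u ^ m\<close> is a tail of a convergent series.\<close>

lemma powser_divided_remainder:
  fixes d :: "nat \<Rightarrow> complex"
  assumes F: "\<And>u. u \<in> \<D> \<Longrightarrow> (\<lambda>k. d k * u ^ k) sums F u"
  obtains Q where "Q holomorphic_on \<D>"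
    "\<And>u. u \<in> \<D> \<Longrightarrow> F u - (\<Sum>k<m. d k * u ^ k) = u ^ m * Q u"
proof
  define Q where "Q = (\<lambda>u. \<Sum>k. d (k + m) * u ^ k)"
  have sm: "summable (\<lambda>k. d (k + m) * u ^ k)" if "u \<in> \<D>" for u
  proof (cases "u = 0")
    case False
    have "summable (\<lambda>k. d (k + m) * u ^ (k + m))"
      using F[OF that] by (intro summable_ignore_initial_segment) (rule sums_summable)
    then have "summable (\<lambda>k. u ^ m * (d (k + m) * u ^ k))"
      by (simp add: power_add mult_ac)
    then show ?thesis using False by simp
  qed (auto intro: summable_finite[of "{0}"])
  show "Q holomorphic_on \<D>"
    by (rule power_series_holomorphic[where a = "\<lambda>k. d (k + m)"])
       (use sm in \<open>simp add: Q_def summable_sums\<close>)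
  fix u assume u: "u \<in> \<D>"
  have "F u - (\<Sum>k<m. d k * u ^ k) = (\<Sum>k. d (k + m) * u ^ (k + m))"
    using suminf_minus_initial_segment[OF sums_summable[OF F[OF u]], of m] sums_unique[OF F[OF u]]
    by simp
  also have "\<dots> = (\<Sum>k. u ^ m * (d (k + m) * u ^ k))"
    by (simp add: power_add mult_ac)
  also have "\<dots> = u ^ m * Q u"
    unfolding Q_def by (rule suminf_mult[OF sm[OF u]])
  finally show "F u - (\<Sum>k<m. d k * u ^ k) = u ^ m * Q u" .
qed

text \<open>The Taylor coefficients at 0 of (1 - x) to the power \<open>- \<alpha>\<close>; the
  Pochhammer form makes their nonnegativity for positive \<open>\<alpha>\<close> visible.\<close>

definition kern_coeff :: "real \<Rightarrow> nat \<Rightarrow> real" where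
  "kern_coeff \<alpha> k = pochhammer \<alpha> k / fact k"

lemma kern_coeff_nonneg: "\<alpha> > 0 \<Longrightarrow> kern_coeff \<alpha> k \<ge> 0"
  by (simp add: kern_coeff_def pochhammer_nonneg)

lemma kern_coeff_sums_real:
  assumes "\<bar>x\<bar> < 1"
  shows "(\<lambda>k. kern_coeff \<alpha> k * x ^ k) sums (1 - x) powr (- \<alpha>)"
proof -
  have "((- \<alpha>) gchoose k) * (- x) ^ k = kern_coeff \<alpha> k * x ^ k" for k
    by (simp add: gbinomial_pochhammer kern_coeff_def power_minus[of x])
  then show ?thesis using gen_binomial_real[of "- x" "- \<alpha>"] assms by simp
qed

lemma kern_coeff_sums:
  assumes "cmod x < 1"
  shows "(\<lambda>k. of_real (kern_coeff \<alpha> k) * x ^ k) sums (1 - x) powr (- of_real \<alpha>)"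
proof -
  have "((- of_real \<alpha>) gchoose k) * (- x) ^ k = of_real (kern_coeff \<alpha> k) * x ^ k" for k
    by (simp add: gbinomial_pochhammer kern_coeff_def power_minus[of x] pochhammer_of_real)
  then show ?thesis using gen_binomial_complex[of "- x" "- of_real \<alpha>"] assms by simp
qed

definition kern_taylor :: "real \<Rightarrow> complex \<Rightarrow> nat \<Rightarrow> complex \<Rightarrow> complex" where
  "kern_taylor \<alpha> a m u =
     of_real ((1 - (cmod a)\<^sup>2) powr (\<alpha> / 2)) * (\<Sum>k<m. of_real (kern_coeff \<alpha> k) * (cnj a * u) ^ k)"

lemma kern_taylor_remainder:
  assumes a: "a \<in> \<D>"
  obtains Q where "Q holomorphic_on \<D>"
    "\<And>u. u \<in> \<D> \<Longrightarrow> kern \<alpha> a u - kern_taylor \<alpha> a m u = u ^ m * Q u"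
proof -
  define d where "d = (\<lambda>k. of_real ((1 - (cmod a)\<^sup>2) powr (\<alpha> / 2)) * (of_real (kern_coeff \<alpha> k) * cnj a ^ k))"
  have "(\<lambda>k. d k * u ^ k) sums kern \<alpha> a u" if "u \<in> \<D>" for u
  proof -
    have "cmod (cnj a * u) < 1"
      using a that mult_strict_mono'[of "cmod a" 1 "cmod u" 1] by (simp add: norm_mult)
    from sums_mult[OF kern_coeff_sums[OF this], of "of_real ((1 - (cmod a)\<^sup>2) powr (\<alpha> / 2))" \<alpha>]
    show ?thesis by (simp add: kern_def d_def power_mult_distrib mult_ac)
  qed
  then obtain Q where "Q holomorphic_on \<D>"
    "\<And>u. u \<in> \<D> \<Longrightarrow> kern \<alpha> a u - (\<Sum>k<m. d k * u ^ k) = u ^ m * Q u"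
    using powser_divided_remainder[of d "kern \<alpha> a" m] by blast
  moreover have "(\<Sum>k<m. d k * u ^ k) = kern_taylor \<alpha> a m u" for u
    by (simp add: kern_taylor_def d_def sum_distrib_left power_mult_distrib mult_ac)
  ultimately show thesis using that by simp
qed

text \<open>Beyond the radius \<open>s = m / (m + 1)\<close> the partial sum grows by at most the factor
  \<open>s ^ - m \<le> exp 1\<close>, so its size is governed by the full series at \<open>min x s\<close>.\<close>

lemma kern_coeff_partial_sum_le:
  assumes \<alpha>: "\<alpha> > 0" and m: "m \<ge> 1" and x: "0 \<le> x" "x < 1"
  shows "(1 - x\<^sup>2) powr (\<alpha> / 2) * (\<Sum>k<m. kern_coeff \<alpha> k * x ^ k) \<le> exp 1 * (4 * real m) powr (\<alpha> / 2)"
proof -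
  define s where "s = real m / (real m + 1)"
  have s: "0 < s" "s < 1" using m by (simp_all add: s_def)
  have inv_s: "1 / s = 1 + 1 / m" using m by (simp add: s_def field_simps)
  have "(1 / s) ^ m \<le> exp (1 / m) ^ m"
    unfolding inv_s by (intro power_mono exp_ge_add_one_self) auto
  also have "\<dots> = exp 1" using m by (simp flip: exp_of_nat_mult)
  finally have sm: "1 \<le> exp 1 * s ^ m" using s by (simp add: power_divide pos_divide_le_eq)
  define y where "y = min x s"
  have y: "0 \<le> y" "y < 1" "y \<le> x" "y \<le> s" using x s by (auto simp: y_def)
  have "x ^ k \<le> exp 1 * y ^ k" if "k < m" for k
  proof (cases "x \<le> s")
    case True
    have "1 * x ^ k \<le> exp 1 * x ^ k" using x by (intro mult_right_mono) auto
    then show ?thesis using True by (simp add: y_def)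
  next
    case False
    have "x ^ k \<le> 1" using x by (simp add: power_le_one)
    also have "1 \<le> exp 1 * s ^ m" by (rule sm)
    also have "\<dots> \<le> exp 1 * s ^ k" using s that by (intro mult_left_mono power_decreasing) auto
    finally show ?thesis using False by (simp add: y_def)
  qed
  then have "(\<Sum>k<m. kern_coeff \<alpha> k * x ^ k) \<le> (\<Sum>k<m. kern_coeff \<alpha> k * (exp 1 * y ^ k))"
    using kern_coeff_nonneg[OF \<alpha>] by (intro sum_mono mult_left_mono) auto
  also have "\<dots> = exp 1 * (\<Sum>k<m. kern_coeff \<alpha> k * y ^ k)"
    by (simp add: sum_distrib_left mult_ac)
  also have "(\<Sum>k<m. kern_coeff \<alpha> k * y ^ k) \<le> (1 - y) powr (- \<alpha>)"
  proof -
    have sums: "(\<lambda>k. kern_coeff \<alpha> k * y ^ k) sums (1 - y) powr (- \<alpha>)"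
      using y by (intro kern_coeff_sums_real) auto
    then show ?thesis
      using kern_coeff_nonneg[OF \<alpha>] y sum_le_suminf[OF sums_summable[OF sums], of "{..<m}"]
        sums_unique[OF sums] by simp
  qed
  finally have S: "(\<Sum>k<m. kern_coeff \<alpha> k * x ^ k) \<le> exp 1 * (1 - y) powr (- \<alpha>)" by simp
  have W: "1 - x\<^sup>2 \<le> 2 * (1 - y)"
  proof -
    have "1 - x\<^sup>2 = (1 + x) * (1 - x)" by (simp add: power2_eq_square algebra_simps)
    also have "\<dots> \<le> 2 * (1 - y)" using x y by (intro mult_mono) auto
    finally show ?thesis .
  qed
  have "0 \<le> 1 - x\<^sup>2" using x by (simp add: power_le_one)
  then have "(1 - x\<^sup>2) powr (\<alpha> / 2) * (\<Sum>k<m. kern_coeff \<alpha> k * x ^ k)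
    \<le> (2 * (1 - y)) powr (\<alpha> / 2) * (exp 1 * (1 - y) powr (- \<alpha>))"
    using W S \<alpha> x kern_coeff_nonneg[OF \<alpha>]
    by (intro mult_mono powr_mono2 sum_nonneg mult_nonneg_nonneg) auto
  also have "\<dots> = exp 1 * (2 powr (\<alpha> / 2) * ((1 - y) powr (\<alpha> / 2) * (1 - y) powr (- \<alpha>)))"
    using y by (subst powr_mult) auto
  also have "(1 - y) powr (\<alpha> / 2) * (1 - y) powr (- \<alpha>) = (1 - y) powr (- (\<alpha> / 2))"
    by (simp flip: powr_add)
  \<comment> \<open>From \<open>y \<le> s\<close> follows
    \<open>1 - y \<ge> 1 / (m + 1) \<ge> 1 / (2 * m)\<close>, using \<open>m \<ge> 1\<close>.
    Together with the factor 2 in \<open>W\<close> this produces \<open>4 * m\<close>.\<close>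
  also have "\<dots> \<le> (2 * real m) powr (\<alpha> / 2)"
  proof -
    have "1 / (real m + 1) = 1 - s" using m by (simp add: s_def field_simps)
    also have "\<dots> \<le> 1 - y" using y by simp
    finally have "1 / (1 - y) \<le> real m + 1" using y by (simp add: field_simps)
    also have "\<dots> \<le> 2 * real m" using m by simp
    finally have "(1 / (1 - y)) powr (\<alpha> / 2) \<le> (2 * real m) powr (\<alpha> / 2)"
      using \<alpha> y by (intro powr_mono2) auto
    then show ?thesis using y by (simp add: powr_minus_divide powr_divide)
  qed
  also have "exp 1 * (2 powr (\<alpha> / 2) * (2 * real m) powr (\<alpha> / 2)) = exp 1 * (4 * real m) powr (\<alpha> / 2)"
    by (simp flip: powr_mult)
  finally show ?thesis by simp
qed

text \<open>Smallness comes only from the normalising factor of the kernel. Inside the sum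
  \<open>cmod a\<close> is replaced by 1, and the partial sum at \<open>cmod u\<close> grows only
  like \<open>m powr (\<alpha> / 2)\<close> against the weight.\<close>

lemma weighted_kern_taylor_le:
  assumes \<alpha>: "\<alpha> > 0" and m: "m \<ge> 1" and a: "a \<in> \<D>" and u: "u \<in> \<D>"
  shows "weighted \<alpha> (kern_taylor \<alpha> a m) u \<le> exp 1 * (4 * real m * (1 - (cmod a)\<^sup>2)) powr (\<alpha> / 2)"
proof -
  let ?A = "(1 - (cmod a)\<^sup>2) powr (\<alpha> / 2)"
  have "cmod (\<Sum>k<m. of_real (kern_coeff \<alpha> k) * (cnj a * u) ^ k)
      \<le> (\<Sum>k<m. kern_coeff \<alpha> k * cmod u ^ k)"
  proof (rule sum_norm_le)
    fix k
    have "cmod (cnj a * u) \<le> cmod u"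
      using a by (simp add: norm_mult mult_left_le_one_le)
    then show "cmod (of_real (kern_coeff \<alpha> k) * (cnj a * u) ^ k) \<le> kern_coeff \<alpha> k * cmod u ^ k"
      using kern_coeff_nonneg[OF \<alpha>, of k] unfolding norm_mult[of "of_real _"] norm_power
      by (auto intro!: mult_mono power_mono)
  qed
  then have "weighted \<alpha> (kern_taylor \<alpha> a m) u \<le>
      (1 - (cmod u)\<^sup>2) powr (\<alpha> / 2) * (?A * (\<Sum>k<m. kern_coeff \<alpha> k * cmod u ^ k))"
    unfolding weighted_def kern_taylor_def norm_mult by (intro mult_mono) auto
  also have "\<dots> = ?A * ((1 - (cmod u)\<^sup>2) powr (\<alpha> / 2) * (\<Sum>k<m. kern_coeff \<alpha> k * cmod u ^ k))"
    by simp
  also have "\<dots> \<le> ?A * (exp 1 * (4 * real m) powr (\<alpha> / 2))"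
    using kern_coeff_partial_sum_le[OF \<alpha> m, of "cmod u"] u by (intro mult_left_mono) auto
  also have "\<dots> = exp 1 * (4 * real m * (1 - (cmod a)\<^sup>2)) powr (\<alpha> / 2)"
    using one_minus_cmod_square_pos[OF a] by (simp add: powr_mult)
  finally show ?thesis .
qed

section \<open>Necessity of the covering condition\<close>

lemma kern_in_growth_space:
  assumes "\<alpha> > 0" "z \<in> \<D>" shows "kern \<alpha> z \<in> growth_space \<alpha>"
proof (rule growth_spaceI[OF kern_holomorphic[OF assms(2)]])
  fix w assume "w \<in> \<D>"
  then show "weighted \<alpha> (kern \<alpha> z) w \<le> 1"
    using assms one_minus_cmod_square_pos[OF moebius_in_disk[OF assms(2)], of w]
    by (simp add: weighted_kern powr_le1)
qed

text \<open>At the point \<open>z\<close> itself the involution vanishes, so the weighted modulus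
  there is 1.\<close>

lemma one_le_growth_norm_kern:
  assumes "\<alpha> > 0" "z \<in> \<D>" shows "1 \<le> growth_norm \<alpha> (kern \<alpha> z)"
  using weighted_le_growth_norm[OF kern_in_growth_space[OF assms] assms(2)] assms
  by (simp add: weighted_kern moebius_def)

text \<open>The Taylor polynomial at the origin, transported back to \<open>l\<close>, differs from
  \<open>kern \<alpha> z\<close> by a function vanishing to order \<open>m\<close> at
  \<open>l\<close>. Transport preserves weighted moduli, so the bound for the polynomial carries
  over.\<close>

lemma quotient_norm_kern_le:
  assumes \<alpha>: "\<alpha> > 0" and m: "m \<ge> 1" and l: "l \<in> \<D>" and z: "z \<in> \<D>"
  shows "quotient_norm \<alpha> l m (kern \<alpha> z)
    \<le> exp 1 * (4 * real m * (1 - (cmod (moebius l z))\<^sup>2)) powr (\<alpha> / 2)" (is "_ \<le> ?B")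
proof -
  define a where "a = moebius l z"
  have a: "a \<in> \<D>" unfolding a_def by (rule moebius_in_disk[OF l z])
  obtain c where c: "cmod c = 1"
    "\<And>w. w \<in> \<D> \<Longrightarrow> kern \<alpha> z w = c * transport \<alpha> l (kern \<alpha> a) w"
    using kern_eq_transport[OF l z] unfolding a_def by metis
  obtain Q where Q: "Q holomorphic_on \<D>"
    "\<And>u. u \<in> \<D> \<Longrightarrow> kern \<alpha> a u - kern_taylor \<alpha> a m u = u ^ m * Q u"
    using kern_taylor_remainder[OF a] by metis
  define h where "h = (\<lambda>w. c * transport \<alpha> l (kern_taylor \<alpha> a m) w)"
  have h_le: "weighted \<alpha> h w \<le> ?B" if "w \<in> \<D>" for w
  proof -
    have "weighted \<alpha> h w = weighted \<alpha> (transport \<alpha> l (kern_taylor \<alpha> a m)) w"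
      by (simp add: weighted_def h_def norm_mult c)
    also have "\<dots> \<le> ?B"
      using weighted_kern_taylor_le[OF \<alpha> m a moebius_in_disk[OF l that]]
      unfolding weighted_transport[OF l that] a_def .
    finally show ?thesis .
  qed
  have "kern_taylor \<alpha> a m holomorphic_on \<D>"
    unfolding kern_taylor_def[abs_def] by (intro holomorphic_intros)
  then have "h holomorphic_on \<D>"
    unfolding h_def using l by (intro holomorphic_on_mult transport_holomorphic holomorphic_on_const)
  then have hs: "h \<in> growth_space \<alpha>" using h_le by (rule growth_spaceI)
  have ks: "kern \<alpha> z \<in> growth_space \<alpha>" by (rule kern_in_growth_space[OF \<alpha> z])
  have "(\<lambda>w. kern \<alpha> z w - h w) \<in> vanishing_space \<alpha> l m"
    unfolding vanishing_space_iff[OF l]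
  proof (intro conjI growth_space_diff ks hs exI ballI)
    \<comment> \<open>The involution has a zero at \<open>l\<close> with cofactor
      \<open>-1 / (1 - cnj l * w)\<close>, whose m-th power appears here.\<close>
    let ?q = "\<lambda>w. c * ((-1 / (1 - cnj l * w)) ^ m * transport \<alpha> l Q w)"
    show "?q holomorphic_on \<D>"
      using one_minus_cnj_mult_nonzero[OF l] l Q
      by (intro holomorphic_on_mult holomorphic_intros transport_holomorphic) auto
    fix w assume w: "w \<in> \<D>"
    have "moebius l w = (w - l) * (-1 / (1 - cnj l * w))"
      by (simp add: moebius_def diff_divide_distrib)
    then have mw: "moebius l w ^ m = (w - l) ^ m * (-1 / (1 - cnj l * w)) ^ m"
      by (metis power_mult_distrib)
    have "kern \<alpha> z w - h w = c * ((kern \<alpha> a (moebius l w) - kern_taylor \<alpha> a m (moebius l w)) * kern \<alpha> l w)"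
      by (simp add: c(2)[OF w] h_def transport_def algebra_simps)
    also have "\<dots> = c * ((moebius l w ^ m * Q (moebius l w)) * kern \<alpha> l w)"
      by (simp only: Q(2)[OF moebius_in_disk[OF l w]])
    also have "\<dots> = (w - l) ^ m * ?q w"
      unfolding mw transport_def by (simp only: mult_ac)
    finally show "kern \<alpha> z w - h w = (w - l) ^ m * ?q w" .
  qed
  from quotient_norm_le[OF ks this]
  have "quotient_norm \<alpha> l m (kern \<alpha> z) \<le> growth_norm \<alpha> h" by simp
  also have "\<dots> \<le> ?B" using h_le by (rule growth_norm_leI)
  finally show ?thesis .
qed

lemma covering_if_sampling_divisor:
  assumes \<alpha>: "\<alpha> > 0" and X: "divisor \<Lambda> m" and S: "sampling_divisor \<alpha> \<Lambda> m"
  shows "\<exists>C. 0 < C \<and> C < \<alpha> \<and>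
    (\<Union>l\<in>\<Lambda>. pseudohyperbolic_disk l (sqrt ((real (m l) + C) / (real (m l) + \<alpha>)))) = \<D>"
proof -
  obtain L where L: "L > 0" and samp: "\<And>f. f \<in> growth_space \<alpha> \<Longrightarrow>
      growth_norm \<alpha> f \<le> L * Sup (insert 0 ((\<lambda>l. quotient_norm \<alpha> l (m l) f) ` \<Lambda>))"
    using S unfolding sampling_divisor_def by blast
  \<comment> \<open>Chosen so that \<open>L * (exp 1 * b)\<close> is \<open>1 / 2\<close>, below the
    lower bound 1 for the norm of the kernel.\<close>
  define b where "b = 1 / (2 * L * exp 1)"
  have b: "b > 0" using L by (simp add: b_def)
  \<comment> \<open>The first entry keeps \<open>C = \<alpha> - \<epsilon>\<close> positive; the
    second is what \<open>(4 * \<epsilon>) powr (\<alpha> / 2) \<le> b\<close> requires.\<close>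
  define \<epsilon> where "\<epsilon> = min (\<alpha> / 2) (b powr (2 / \<alpha>) / 4)"
  have \<epsilon>: "0 < \<epsilon>" "\<epsilon> < \<alpha>" using \<alpha> b by (auto simp: \<epsilon>_def)
  have \<epsilon>b: "(4 * \<epsilon>) powr (\<alpha> / 2) \<le> b"
  proof -
    have "(4 * \<epsilon>) powr (\<alpha> / 2) \<le> (b powr (2 / \<alpha>)) powr (\<alpha> / 2)"
      using \<alpha> \<epsilon> by (intro powr_mono2) (auto simp: \<epsilon>_def)
    also have "\<dots> = b" using \<alpha> b by (simp add: powr_powr)
    finally show ?thesis .
  qed
  have "\<exists>l\<in>\<Lambda>. z \<in> pseudohyperbolic_disk l (sqrt ((real (m l) + (\<alpha> - \<epsilon>)) / (real (m l) + \<alpha>)))"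
    if z: "z \<in> \<D>" for z
  proof (rule ccontr)
    assume neg: "\<not> ?thesis"
    have q: "quotient_norm \<alpha> l (m l) (kern \<alpha> z) \<le> exp 1 * b" if l: "l \<in> \<Lambda>" for l
    proof -
      have lD: "l \<in> \<D>" and m: "m l \<ge> 1" using X l by (auto simp: divisor_def)
      have "sqrt ((real (m l) + (\<alpha> - \<epsilon>)) / (real (m l) + \<alpha>)) \<le> cmod (moebius l z)"
        using neg l z by (auto simp: pseudohyperbolic_disk_def moebius_def not_less)
      then have "(real (m l) + (\<alpha> - \<epsilon>)) / (real (m l) + \<alpha>) \<le> (cmod (moebius l z))\<^sup>2"
        by (rule sqrt_le_D)
      moreover have "1 - (real (m l) + (\<alpha> - \<epsilon>)) / (real (m l) + \<alpha>) = \<epsilon> / (real (m l) + \<alpha>)"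
        using \<alpha> by (simp add: field_simps)
      ultimately have "1 - (cmod (moebius l z))\<^sup>2 \<le> \<epsilon> / (real (m l) + \<alpha>)" by linarith
      also have "\<dots> \<le> \<epsilon> / real (m l)" using \<epsilon> \<alpha> m by (intro divide_left_mono) auto
      finally have "4 * real (m l) * (1 - (cmod (moebius l z))\<^sup>2) \<le> 4 * \<epsilon>"
        using m by (simp add: field_simps)
      then have "(4 * real (m l) * (1 - (cmod (moebius l z))\<^sup>2)) powr (\<alpha> / 2) \<le> (4 * \<epsilon>) powr (\<alpha> / 2)"
        using \<alpha> one_minus_cmod_square_pos[OF moebius_in_disk[OF lD z]] by (intro powr_mono2) auto
      also note \<epsilon>b
      finally show ?thesis
        using quotient_norm_kern_le[OF \<alpha> m lD z] by (smt (verit) mult_left_mono exp_gt_zero)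
    qed
    have "1 \<le> L * Sup (insert 0 ((\<lambda>l. quotient_norm \<alpha> l (m l) (kern \<alpha> z)) ` \<Lambda>))"
      using one_le_growth_norm_kern[OF \<alpha> z] samp[OF kern_in_growth_space[OF \<alpha> z]] by linarith
    \<comment> \<open>The inserted 0 also lies below \<open>exp 1 * b\<close>, so an empty
      \<open>\<Lambda>\<close> is handled in the same way.\<close>
    also have "\<dots> \<le> L * (exp 1 * b)"
      using q b L by (intro mult_left_mono cSup_least) auto
    also have "\<dots> = 1 / 2" using L by (simp add: b_def)
    finally show False by simp
  qed
  then have "(\<Union>l\<in>\<Lambda>. pseudohyperbolic_disk l (sqrt ((real (m l) + (\<alpha> - \<epsilon>)) / (real (m l) + \<alpha>)))) = \<D>"
    by (auto simp: pseudohyperbolic_disk_def)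
  then show ?thesis using \<epsilon> by (intro exI[of _ "\<alpha> - \<epsilon>"]) auto
qed

theorem theorem4p4:
  fixes \<alpha> :: real and \<Lambda> :: "complex set" and m :: "complex \<Rightarrow> nat"
  assumes "\<alpha> > 0" and "divisor \<Lambda> m"
  shows "(sampling_divisor \<alpha> \<Lambda> m \<longrightarrow>
            (\<exists>C. 0 < C \<and> C < \<alpha> \<and>
               (\<Union>l\<in>\<Lambda>. pseudohyperbolic_disk l
                  (sqrt ((real (m l) + C) / (real (m l) + \<alpha>)))) = \<D>))
       \<and> ((\<exists>C>0. \<exists>K. compact K \<and> K \<subseteq> \<D> \<and>
               (\<Union>l\<in>{l\<in>\<Lambda>. real (m l) > C}. pseudohyperbolic_disk l
                  (sqrt ((real (m l) - C) / (real (m l) + \<alpha>)))) = \<D> - K)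
            \<longrightarrow> sampling_divisor \<alpha> \<Lambda> m)"
proof (intro conjI impI)
  show "sampling_divisor \<alpha> \<Lambda> m \<Longrightarrow> \<exists>C. 0 < C \<and> C < \<alpha> \<and>
    (\<Union>l\<in>\<Lambda>. pseudohyperbolic_disk l (sqrt ((real (m l) + C) / (real (m l) + \<alpha>)))) = \<D>"
    by (rule covering_if_sampling_divisor[OF assms])
next
  assume "\<exists>C>0. \<exists>K. compact K \<and> K \<subseteq> \<D> \<and>
    (\<Union>l\<in>{l\<in>\<Lambda>. real (m l) > C}. pseudohyperbolic_disk l
      (sqrt ((real (m l) - C) / (real (m l) + \<alpha>)))) = \<D> - K"
  then obtain C K where "C > 0" "compact K" "K \<subseteq> \<D>"
    "(\<Union>l\<in>{l\<in>\<Lambda>. real (m l) > C}. pseudohyperbolic_disk l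
      (sqrt ((real (m l) - C) / (real (m l) + \<alpha>)))) = \<D> - K" by blast
  then show "sampling_divisor \<alpha> \<Lambda> m"
    using assms by (intro sampling_divisor_if_covering[of \<alpha> \<Lambda> C K]) (auto simp: divisor_def)
qed

end
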